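(* Let $Y$ be a vertex algebra structure on the chiral boson. Given finite sets $S_1,S_2\subset\mathbb P\setminus P$, states $\mathtt v_1\in{}_{S_1}\mathbf W$ and $\mathtt v_2\in{}_{S_2}\mathbf W$, and a translation $v$ with $S_2\cap(S_1+v)=\emptyset$ (so that both sides are defined), one has $$Y(\mathtt v_1,v)\mathtt v_2=\mathsf T_v\,Y(\mathtt v_2,-v)\mathtt v_1 .$$
   Context: Fix a point $P$ of a complex projective line $\mathbb P$. Translations are the automorphisms in the additive group ($\cong\mathbb C$) of translations of the affine line $\mathbb P\setminus P$; $z+v$ is the action of $v$ on $z$; in a coordinate $u$ with pole at $P$, $u(z+v)=u(z)+u(v)$. $\mathbf K$ is the space of meromorphic 1-forms on $\mathbb P$ with all residues zero, regular at $P$; $\mathbf W=S^*\mathbf K$, vacuum $\mathbf 1$. For a finite set $S\subset\mathbb P\setminus P$: ${}_S\mathbf W=S^*({}_S\mathbf K)$ with ${}_S\mathbf K\subset\mathbf K$ the forms with all poles in $S$; $\mathbf W^S=S^*(\mathbf K^S)$ with $\mathbf K^S\subset\mathbf K$ the forms regular at every point of $S$. $\mathsf T_v:\mathbf W\to\mathbf W$ is induced by $a(u)du\mapsto a(u-u(v))du$ and maps ${}_S\mathbf W$ to ${}_{S+v}\mathbf W$. For $O\ne P$ and $\lambda\in\mathbb C^*=\mathrm{Aut}_{O,P}(\mathbb P)$ acting by $u(\lambda(z))=\lambda u(z)$ (with $u(O)=0$, $u(P)=\infty$), $\mathsf R_\lambda$ is the operator on $\mathbf W$ induced by pull-back by $\lambda^{-1}$.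 A vertex algebra structure on the chiral boson is an assignment, linear in the state, to each finite set $S$, state $\mathtt v\in{}_S\mathbf W$ and translation $v$ of an operator $Y(\mathtt v,v):\mathbf W^{S+v}\to\mathbf W$ (compatible with enlarging $S$), such that: 1. if $\mathtt v'\in{}_{S'}\mathbf W\cap\mathbf W^{S+v}$ then $Y(\mathtt v,v)\mathtt v'\in{}_{S'\cup(S+v)}\mathbf W$; 2. $Y(\mathbf 1,v)=\mathrm{Id}$; 3. $Y(\mathtt v,0)\mathbf 1=\mathtt v$; 4. for $\mathtt v\in{}_S\mathbf W$, $\mathtt v'\in{}_{S'}\mathbf W$, the operators $Y(\mathtt v,v)$ and $Y(\mathtt v',v')$ commute if $S+v$ is disjoint from $S'+v'$ (where both compositions are defined); 5. $Y(\mathtt v,v+v')=\mathsf T_{v'}\circ Y(\mathtt v,v)\circ\mathsf T_{-v'}$ for translations $v,v'$; 6. $Y$ is $\mathrm{Aut}_P(\mathbb P)$-covariant: $Y(\mathsf T_{v'}\mathtt v,v)=\mathsf T_{v'}Y(\mathtt v,v)\mathsf T_{-v'}$ and $Y(\mathsf R_\lambda\mathtt v,\lambda v)=\mathsf R_\lambda Y(\mathtt v,v)\mathsf R_{\lambda^{-1}}$ for rotations $\lambda$ about any point $O$; 7. for a fixed point $O$, the vectors $Y(\mathtt v_n,v_n)\cdots Y(\mathtt v_1,v_1)\mathbf 1$, over all sequences of distinct translations $v_i$ and states $\mathtt v_i\in{}_{\{O\}}\mathbf W$, span $\mathbf W$. *)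

theory Defs
  imports
    "HOL-Complex_Analysis.Complex_Analysis"
    "HOL-Library.Poly_Mapping"
    "HOL-Library.Multiset"
begin

text \<open>
  A coordinate \<open>u\<close> with pole at \<open>P\<close> identifies the affine line \<open>\<bbbP> - P\<close> with \<open>complex\<close>.
  A translation \<open>v\<close> is the number \<open>u(v)\<close>, so that \<open>v\<close> moves the point \<open>z\<close> to \<open>v + z\<close>
  and the set \<open>S\<close> to \<open>(+) v ` S\<close>.
\<close>

section \<open>The space of forms\<close>

text \<open>With \<open>u = 1 / w\<close> the form \<open>a(u) du\<close> becomes \<open>- a(1 / w) / w\<^sup>2 dw\<close> near \<open>P\<close>.\<close>

definition form_regular_at_infinity :: "(complex \<Rightarrow> complex) \<Rightarrow> bool" where
  "form_regular_at_infinity a \<longleftrightarrow>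
     (\<exists>g. g analytic_on {0} \<and> eventually (\<lambda>w. g w = - a (1 / w) / w\<^sup>2) (at 0))"

definition is_kform :: "(complex \<Rightarrow> complex) \<Rightarrow> bool" where
  "is_kform a \<longleftrightarrow>
     a meromorphic_on UNIV \<and> (\<forall>z. residue a z = 0) \<and> form_regular_at_infinity a"

text \<open>Values on a discrete set are irrelevant to a meromorphic function.\<close>

definition kform_rel :: "(complex \<Rightarrow> complex) \<Rightarrow> (complex \<Rightarrow> complex) \<Rightarrow> bool" where
  "kform_rel a b \<longleftrightarrow> is_kform a \<and> is_kform b \<and> (\<forall>z. eventually (\<lambda>u. a u = b u) (at z))"

lemma is_kform_0: "is_kform (\<lambda>_. 0)"
  unfolding is_kform_def form_regular_at_infinity_def
  by (auto simp: residue_const intro!: exI[of _ "\<lambda>_. 0"])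

lemma eventually_trans_eq:
  assumes "\<forall>z::complex. eventually (\<lambda>u. a u = b u) (at z)" "\<forall>z. eventually (\<lambda>u. b u = c u) (at z)"
  shows "eventually (\<lambda>u. a u = c u) (at z)"
  using assms(1)[rule_format, of z] assms(2)[rule_format, of z] by eventually_elim simp

quotient_type kform = "complex \<Rightarrow> complex" / partial: kform_rel
proof (rule part_equivpI)
  show "\<exists>x. kform_rel x x"
    by (rule exI[of _ "\<lambda>_. 0"]) (simp add: kform_rel_def is_kform_0)
  show "symp kform_rel"
    by (auto simp: symp_def kform_rel_def eq_commute)
  show "transp kform_rel"
    unfolding transp_def kform_rel_def
    by (auto intro: eventually_trans_eq)
qed

lemma is_kform_add:
  assumes "is_kform a" "is_kform b"
  shows "is_kform (\<lambda>u. a u + b u)"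
proof -
  have "residue (\<lambda>u. a u + b u) z = 0" for z
  proof -
    obtain F where F: "(\<lambda>w. a (z + w)) has_laurent_expansion F"
      using assms(1) by (auto simp: is_kform_def meromorphic_on_def)
    obtain G where G: "(\<lambda>w. b (z + w)) has_laurent_expansion G"
      using assms(2) by (auto simp: is_kform_def meromorphic_on_def)
    have "(\<lambda>w. a (z + w) + b (z + w)) has_laurent_expansion F + G"
      by (intro has_laurent_expansion_add F G)
    from has_laurent_expansion_residue[OF this] has_laurent_expansion_residue[OF F]
      has_laurent_expansion_residue[OF G] assms
    show ?thesis by (simp add: is_kform_def)
  qed
  moreover obtain g where g: "g analytic_on {0}" "eventually (\<lambda>w. g w = - a (1 / w) / w\<^sup>2) (at 0)"
    using assms(1) by (auto simp: is_kform_def form_regular_at_infinity_def)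
  moreover obtain h where h: "h analytic_on {0}" "eventually (\<lambda>w. h w = - b (1 / w) / w\<^sup>2) (at 0)"
    using assms(2) by (auto simp: is_kform_def form_regular_at_infinity_def)
  have "form_regular_at_infinity (\<lambda>u. a u + b u)"
    unfolding form_regular_at_infinity_def
  proof (intro exI conjI)
    show "(\<lambda>w. g w + h w) analytic_on {0}"
      using g h by (intro analytic_on_add)
    show "eventually (\<lambda>w. g w + h w = - (a (1 / w) + b (1 / w)) / w\<^sup>2) (at 0)"
      using g(2) h(2) by eventually_elim (simp add: diff_divide_distrib)
  qed
  ultimately show ?thesis
    using assms by (auto simp: is_kform_def intro: meromorphic_on_add)
qed

lemma is_kform_affine:
  assumes "is_kform a"
  shows "is_kform (\<lambda>u. c * a (c * u + b))"
proof (cases "c = 0")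
  case True
  then show ?thesis by (simp add: is_kform_0)
next
  case c: False
  have mero: "(\<lambda>u. a (c * u + b)) meromorphic_on UNIV"
  proof (rule meromorphic_on_compose[where g = a and f = "\<lambda>u. c * u + b" and A = UNIV])
    show "a meromorphic_on UNIV"
      using assms by (simp add: is_kform_def)
    show "(\<lambda>u. c * u + b) analytic_on UNIV"
      by (intro analytic_intros)
  qed simp
  have res: "residue (\<lambda>u. c * a (c * u + b)) z = 0" for z
  proof -
    obtain F where F: "(\<lambda>w. a (c * z + b + w)) has_laurent_expansion F"
      using assms by (auto simp: is_kform_def meromorphic_on_def)
    have 0: "fls_nth F (-1) = 0"
      using has_laurent_expansion_residue[OF F] assms by (simp add: is_kform_def)
    have "(\<lambda>w. c * w) has_fps_expansion (fps_const c * fps_X)"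
      by (rule has_fps_expansion_mult[OF has_fps_expansion_const has_fps_expansion_fps_X])
    from has_laurent_expansion_compose[OF F has_laurent_expansion_fps[OF this]]
    have "(\<lambda>w. a (c * z + b + c * w)) has_laurent_expansion fls_compose_fps F (fps_const c * fps_X)"
      using c by (auto simp: o_def)
    then have "(\<lambda>w. c * a (c * (z + w) + b)) has_laurent_expansion
                 fls_const c * fls_compose_fps F (fps_const c * fps_X)"
      by (intro has_laurent_expansion_mult has_laurent_expansion_const) (simp add: algebra_simps)
    from has_laurent_expansion_residue[OF this] show ?thesis
      using 0 fls_nth_fls_compose_fps_linear[OF c, of F "-1"] by simp
  qed
  obtain g where g: "g analytic_on {0}" "eventually (\<lambda>w. g w = - a (1 / w) / w\<^sup>2) (at 0)"
    using assms by (auto simp: is_kform_def form_regular_at_infinity_def)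
  define s where "s = (\<lambda>w. w / (c + b * w))"
  have s: "s analytic_on {0}" "s 0 = 0"
    unfolding s_def using c by (auto intro!: analytic_intros)
  have "isCont (\<lambda>w. c + b * w) 0"
    by (intro continuous_intros)
  then have "((\<lambda>w. c + b * w) \<longlongrightarrow> c) (at 0)"
    by (simp add: isCont_def)
  then have nz: "eventually (\<lambda>w. c + b * w \<noteq> 0) (at 0)"
    using c tendsto_imp_eventually_ne by blast
  have nz': "eventually (\<lambda>w. w \<noteq> (0::complex)) (at 0)"
    by (simp add: eventually_at_filter)
  have "isCont s 0"
    using s(1) by (simp add: analytic_at_imp_isCont)
  then have "(s \<longlongrightarrow> 0) (at 0)"
    using s(2) by (simp add: isCont_def)
  moreover have "eventually (\<lambda>w. s w \<noteq> 0) (at 0)"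
    using nz nz' by eventually_elim (auto simp: s_def)
  ultimately have "filterlim s (at 0) (at 0)"
    by (simp add: filterlim_at)
  with g(2) have ev: "eventually (\<lambda>w. g (s w) = - a (1 / s w) / (s w)\<^sup>2) (at 0)"
    by (rule eventually_compose_filterlim)
  have "form_regular_at_infinity (\<lambda>u. c * a (c * u + b))"
    unfolding form_regular_at_infinity_def
  proof (intro exI conjI)
    have "(g \<circ> s) analytic_on {0}"
      using s g(1) by (intro analytic_on_compose) auto
    then show "(\<lambda>w. c * (g \<circ> s) w / (c + b * w)\<^sup>2) analytic_on {0}"
      using c unfolding o_def by (auto intro!: analytic_intros)
    show "eventually (\<lambda>w. c * (g \<circ> s) w / (c + b * w)\<^sup>2 = - (c * a (c * (1 / w) + b)) / w\<^sup>2) (at 0)"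
      using ev nz nz'
    proof eventually_elim
      case (elim w)
      have "1 / s w = c * (1 / w) + b"
        using elim by (simp add: s_def field_simps)
      moreover have "(s w)\<^sup>2 * (c + b * w)\<^sup>2 = w\<^sup>2"
        using elim by (simp add: s_def power_divide)
      ultimately show ?case
        using elim(1) by (simp add: divide_divide_eq_left)
    qed
  qed
  with mero res show ?thesis
    by (auto simp: is_kform_def intro!: meromorphic_on_mult)
qed

lemma is_kform_cmult:
  assumes "is_kform a"
  shows "is_kform (\<lambda>u. c * a u)"
proof -
  have "residue (\<lambda>u. c * a u) z = 0" for z
  proof -
    obtain F where F: "(\<lambda>w. a (z + w)) has_laurent_expansion F"
      using assms by (auto simp: is_kform_def meromorphic_on_def)
    have "(\<lambda>w. c * a (z + w)) has_laurent_expansion fls_const c * F"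
      by (intro has_laurent_expansion_mult has_laurent_expansion_const F)
    from has_laurent_expansion_residue[OF this] has_laurent_expansion_residue[OF F] assms
    show ?thesis by (simp add: is_kform_def)
  qed
  moreover obtain g where g: "g analytic_on {0}" "eventually (\<lambda>w. g w = - a (1 / w) / w\<^sup>2) (at 0)"
    using assms by (auto simp: is_kform_def form_regular_at_infinity_def)
  have "form_regular_at_infinity (\<lambda>u. c * a u)"
    unfolding form_regular_at_infinity_def
  proof (intro exI conjI)
    show "(\<lambda>w. c * g w) analytic_on {0}"
      using g by (intro analytic_intros)
    show "eventually (\<lambda>w. c * g w = - (c * a (1 / w)) / w\<^sup>2) (at 0)"
      using g(2) by eventually_elim (simp add: field_simps)
  qed
  ultimately show ?thesis
    using assms by (auto simp: is_kform_def intro!: meromorphic_on_mult)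
qed

instantiation kform :: ab_group_add
begin

lift_definition zero_kform :: kform is "\<lambda>_. 0"
  by (simp add: kform_rel_def is_kform_0)

lift_definition plus_kform :: "kform \<Rightarrow> kform \<Rightarrow> kform" is "\<lambda>a b u. a u + b u"
proof -
  fix a b c d assume "kform_rel a b" "kform_rel c d"
  moreover have "eventually (\<lambda>u. a u + c u = b u + d u) (at z)" for z
  proof -
    have "eventually (\<lambda>u. a u = b u) (at z)" "eventually (\<lambda>u. c u = d u) (at z)"
      using \<open>kform_rel a b\<close> \<open>kform_rel c d\<close> by (simp_all add: kform_rel_def)
    then show ?thesis by eventually_elim simp
  qed
  ultimately show "kform_rel (\<lambda>u. a u + c u) (\<lambda>u. b u + d u)"
    by (simp add: kform_rel_def is_kform_add)
qed

lift_definition uminus_kform :: "kform \<Rightarrow> kform" is "\<lambda>a u. - a u"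
proof -
  fix a b assume "kform_rel a b"
  then show "kform_rel (\<lambda>u. - a u) (\<lambda>u. - b u)"
    using is_kform_cmult[of a "-1"] is_kform_cmult[of b "-1"] by (simp add: kform_rel_def)
qed

definition minus_kform :: "kform \<Rightarrow> kform \<Rightarrow> kform" where
  "minus_kform a b = a + - b"

instance
proof
  fix a b c :: kform
  show "a + b + c = a + (b + c)"
    by transfer (simp add: kform_rel_def is_kform_add add.assoc)
  show "a + b = b + a"
    by transfer (simp add: kform_rel_def is_kform_add add.commute)
  show "0 + a = a"
    by transfer (simp add: kform_rel_def)
  show "- a + a = 0"
    by transfer (simp add: kform_rel_def is_kform_0)
qed (simp add: minus_kform_def)

end

lift_definition scale_kform :: "complex \<Rightarrow> kform \<Rightarrow> kform" is "\<lambda>c a u. c * a u"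
  by (auto simp: kform_rel_def is_kform_cmult elim: eventually_mono)

lift_definition pole_of :: "kform \<Rightarrow> complex \<Rightarrow> bool" is is_pole
  unfolding kform_rel_def by (intro ext is_pole_cong) auto

text \<open>
  Pull-back of \<open>a(u) du\<close> along \<open>u \<mapsto> c * u + b\<close>, of which translation and rotation of forms are
  the cases needed. (For \<open>c = 0\<close> it is the zero form.)
\<close>

lift_definition pull_kform :: "complex \<Rightarrow> complex \<Rightarrow> kform \<Rightarrow> kform"
  is "\<lambda>c b a u. c * a (c * u + b)"
proof -
  fix c b and f g :: "complex \<Rightarrow> complex"
  assume rel: "kform_rel f g"
  have "eventually (\<lambda>u. c * f (c * u + b) = c * g (c * u + b)) (at z)" for z
  proof (cases "c = 0")
    case False
    have "isCont (\<lambda>u. c * u + b) z"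
      by (intro continuous_intros)
    moreover have "eventually (\<lambda>u. c * u + b \<noteq> c * z + b) (at z)"
      using False by (auto simp: eventually_at_filter)
    ultimately have "filterlim (\<lambda>u. c * u + b) (at (c * z + b)) (at z)"
      by (simp add: filterlim_at isCont_def)
    moreover have "eventually (\<lambda>u. f u = g u) (at (c * z + b))"
      using rel by (simp add: kform_rel_def)
    ultimately have "eventually (\<lambda>u. f (c * u + b) = g (c * u + b)) (at z)"
      by (rule eventually_compose_filterlim[rotated])
    then show ?thesis
      by eventually_elim simp
  qed auto
  then show "kform_rel (\<lambda>u. c * f (c * u + b)) (\<lambda>u. c * g (c * u + b))"
    using rel is_kform_affine[of f c b] is_kform_affine[of g c b] by (simp add: kform_rel_def)
qed

lemma vector_space_kform: "vector_space scale_kform"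
proof
  fix x y :: complex and a b :: kform
  show "scale_kform x (a + b) = scale_kform x a + scale_kform x b"
    by transfer (simp add: kform_rel_def is_kform_add is_kform_cmult distrib_left)
  show "scale_kform (x + y) a = scale_kform x a + scale_kform y a"
    by transfer (simp add: kform_rel_def is_kform_add is_kform_cmult distrib_right)
  show "scale_kform x (scale_kform y a) = scale_kform (x * y) a"
    by transfer (simp add: kform_rel_def is_kform_cmult mult.assoc)
  show "scale_kform 1 a = a"
    by transfer (simp add: kform_rel_def)
qed

lemma pull_kform_add: "pull_kform c b (x + y) = pull_kform c b x + pull_kform c b y"
proof transfer
  fix c b x y assume "kform_rel x x" "kform_rel y y"
  then have "is_kform (\<lambda>u. c * (x (c * u + b) + y (c * u + b)))"
    using is_kform_affine[of "\<lambda>u. x u + y u" c b] is_kform_add[of x y] by (simp add: kform_rel_def)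
  then show "kform_rel (\<lambda>u. c * (x (c * u + b) + y (c * u + b)))
                       (\<lambda>u. c * x (c * u + b) + c * y (c * u + b))"
    by (simp add: kform_rel_def distrib_left)
qed

lemma pull_kform_scale: "pull_kform c b (scale_kform k x) = scale_kform k (pull_kform c b x)"
proof transfer
  fix c b k x assume "kform_rel x x"
  then have "is_kform (\<lambda>u. c * (k * x (c * u + b)))"
    using is_kform_affine[of "\<lambda>u. k * x u" c b] is_kform_cmult[of x k] by (simp add: kform_rel_def)
  then show "kform_rel (\<lambda>u. c * (k * x (c * u + b))) (\<lambda>u. k * (c * x (c * u + b)))"
    by (simp add: kform_rel_def mult.left_commute)
qed

definition kforms_poles_in :: "complex set \<Rightarrow> kform set" where
  "kforms_poles_in S = {a. \<forall>z. pole_of a z \<longrightarrow> z \<in> S}"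

definition kforms_regular_on :: "complex set \<Rightarrow> kform set" where
  "kforms_regular_on S = {a. \<forall>z\<in>S. \<not> pole_of a z}"

section \<open>The chiral boson\<close>

text \<open>
  \<open>S\<^sup>*K\<close> is the free commutative algebra on the set \<open>K\<close>, whose monomials are the finite multisets
  of forms, modulo the ideal that makes the inclusion of the generators linear.
\<close>

type_synonym free_boson = "kform multiset \<Rightarrow>\<^sub>0 complex"

abbreviation free_mon :: "complex \<Rightarrow> kform multiset \<Rightarrow> free_boson" where
  "free_mon c m \<equiv> Poly_Mapping.single m c"

definition linearity_relations :: "free_boson set" where
  "linearity_relations =
     {free_mon 1 {#a + b#} - free_mon 1 {#a#} - free_mon 1 {#b#} | a b. True} \<union>
     {free_mon 1 {#scale_kform c a#} - free_mon c {#a#} | c a. True}"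

definition linearity_ideal :: "free_boson set" where
  "linearity_ideal = module.span (*) linearity_relations"

lemma module_times: "module ((*) :: 'a::comm_ring_1 \<Rightarrow> 'a \<Rightarrow> 'a)"
  by standard (simp_all add: algebra_simps)

lemmas linearity_ideal_add = module.span_add[OF module_times, where S = linearity_relations, folded linearity_ideal_def]
  and linearity_ideal_diff = module.span_diff[OF module_times, where S = linearity_relations, folded linearity_ideal_def]
  and linearity_ideal_uminus = module.span_neg[OF module_times, where S = linearity_relations, folded linearity_ideal_def]
  and linearity_ideal_mult = module.span_scale[OF module_times, where S = linearity_relations, folded linearity_ideal_def]
  and linearity_ideal_0 = module.span_zero[OF module_times, where S = linearity_relations, folded linearity_ideal_def]
  and linearity_ideal_base = module.span_base[OF module_times, where S = linearity_relations, folded linearity_ideal_def]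

definition boson_rel :: "free_boson \<Rightarrow> free_boson \<Rightarrow> bool" where
  "boson_rel p q \<longleftrightarrow> p - q \<in> linearity_ideal"

quotient_type boson = free_boson / boson_rel
proof (rule equivpI)
  show "reflp boson_rel"
    by (simp add: reflp_def boson_rel_def linearity_ideal_0)
  show "symp boson_rel"
  proof (rule sympI)
    fix p q assume "boson_rel p q"
    then show "boson_rel q p"
      using linearity_ideal_uminus[of "p - q"] by (simp add: boson_rel_def)
  qed
  show "transp boson_rel"
  proof (rule transpI)
    fix p q r assume "boson_rel p q" "boson_rel q r"
    then show "boson_rel p r"
      using linearity_ideal_add[of "p - q" "q - r"] by (simp add: boson_rel_def)
  qed
qed

instantiation boson :: comm_ring_1
begin

lift_definition zero_boson :: boson is 0 .

lift_definition one_boson :: boson is 1 .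

lift_definition plus_boson :: "boson \<Rightarrow> boson \<Rightarrow> boson" is "(+)"
proof -
  fix p q r s assume "boson_rel p q" "boson_rel r s"
  then show "boson_rel (p + r) (q + s)"
    using linearity_ideal_add[of "p - q" "r - s"] by (simp add: boson_rel_def algebra_simps)
qed

lift_definition uminus_boson :: "boson \<Rightarrow> boson" is uminus
proof -
  fix p q assume "boson_rel p q"
  then show "boson_rel (- p) (- q)"
    using linearity_ideal_uminus[of "p - q"] by (simp add: boson_rel_def)
qed

lift_definition minus_boson :: "boson \<Rightarrow> boson \<Rightarrow> boson" is "(-)"
proof -
  fix p q r s assume "boson_rel p q" "boson_rel r s"
  then show "boson_rel (p - r) (q - s)"
    using linearity_ideal_diff[of "p - q" "r - s"] by (simp add: boson_rel_def algebra_simps)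
qed

lift_definition times_boson :: "boson \<Rightarrow> boson \<Rightarrow> boson" is "(*)"
proof -
  fix p q r s assume "boson_rel p q" "boson_rel r s"
  then have "r * (p - q) + q * (r - s) \<in> linearity_ideal"
    by (intro linearity_ideal_add linearity_ideal_mult) (simp_all add: boson_rel_def)
  then show "boson_rel (p * r) (q * s)"
    by (simp add: boson_rel_def algebra_simps)
qed

lemma one_notin_linearity_ideal: "1 \<notin> linearity_ideal"
proof
  define \<epsilon> :: "free_boson \<Rightarrow> complex" where "\<epsilon> p = Poly_Mapping.lookup p {#}" for p
  have \<epsilon>_mult: "\<epsilon> (p * q) = \<epsilon> p * \<epsilon> q" for p q
  proof -
    have *: "({#} = m + n) = (m = {#} \<and> n = {#})" for m n :: "kform multiset"
      by (metis empty_eq_union)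
    have "\<epsilon> (p * q) =
        Sum_any (\<lambda>m. Poly_Mapping.lookup p m * Sum_any (\<lambda>n. Poly_Mapping.lookup q n when {#} = m + n))"
      by (simp add: \<epsilon>_def times_poly_mapping.rep_eq prod_fun_def)
    also have "(\<lambda>m. Sum_any (\<lambda>n. Poly_Mapping.lookup q n when {#} = m + n)) = (\<lambda>m. \<epsilon> q when m = {#})"
      by (rule ext, rename_tac m, case_tac "m = {#}") (simp_all add: * \<epsilon>_def)
    also have "Sum_any (\<lambda>m. Poly_Mapping.lookup p m * (\<epsilon> q when m = {#})) = \<epsilon> p * \<epsilon> q"
      by (simp add: mult_when \<epsilon>_def)
    finally show ?thesis .
  qed
  assume "1 \<in> linearity_ideal"
  then have "\<epsilon> 1 = 0"
    unfolding linearity_ideal_def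
  proof (induction rule: module.span_induct_alt[OF module_times, consumes 1])
    case 1
    show ?case by (simp add: \<epsilon>_def)
  next
    case (2 c x y)
    then have "\<epsilon> x = 0"
      by (auto simp: linearity_relations_def \<epsilon>_def lookup_minus lookup_single)
    with 2 show ?case
      using \<epsilon>_mult[of c x] by (simp add: \<epsilon>_def lookup_add)
  qed
  then show False
    by (simp add: \<epsilon>_def lookup_one)
qed

instance
proof
  fix p q r :: boson
  show "p + q + r = p + (q + r)" by transfer (simp add: boson_rel_def linearity_ideal_0 add_ac)
  show "p + q = q + p" by transfer (simp add: boson_rel_def linearity_ideal_0 add_ac)
  show "0 + p = p" by transfer (simp add: boson_rel_def linearity_ideal_0)
  show "- p + p = 0" by transfer (simp add: boson_rel_def linearity_ideal_0)
  show "p - q = p + - q" by transfer (simp add: boson_rel_def linearity_ideal_0)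
  show "p * q * r = p * (q * r)" by transfer (simp add: boson_rel_def linearity_ideal_0 mult_ac)
  show "p * q = q * p" by transfer (simp add: boson_rel_def linearity_ideal_0 mult_ac)
  show "1 * p = p" by transfer (simp add: boson_rel_def linearity_ideal_0)
  show "(p + q) * r = p * r + q * r"
    by transfer (simp add: boson_rel_def linearity_ideal_0 distrib_right)
  show "(0::boson) \<noteq> 1"
    using one_notin_linearity_ideal linearity_ideal_uminus[of "-1"]
    by transfer (auto simp: boson_rel_def)
qed

end

lift_definition scale_boson :: "complex \<Rightarrow> boson \<Rightarrow> boson" is "\<lambda>c p. free_mon c {#} * p"
proof -
  fix c p q assume "boson_rel p q"
  then show "boson_rel (free_mon c {#} * p) (free_mon c {#} * q)"
    using linearity_ideal_mult[of "p - q"] by (simp add: boson_rel_def right_diff_distrib)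
qed

global_interpretation boson: vector_space scale_boson
proof
  fix x y :: complex and p q :: boson
  show "scale_boson x (p + q) = scale_boson x p + scale_boson x q"
    by transfer (simp add: boson_rel_def linearity_ideal_0 distrib_left)
  show "scale_boson (x + y) p = scale_boson x p + scale_boson y p"
    by transfer (simp add: boson_rel_def linearity_ideal_0 single_add distrib_right)
  show "scale_boson x (scale_boson y p) = scale_boson (x * y) p"
    by transfer (simp add: boson_rel_def linearity_ideal_0 mult_single flip: mult.assoc)
  show "scale_boson 1 p = p"
    by transfer (simp add: boson_rel_def linearity_ideal_0)
qed

lift_definition of_kform :: "kform \<Rightarrow> boson" is "\<lambda>a. free_mon 1 {#a#}" .

lemma of_kform_add: "of_kform (a + b) = of_kform a + of_kform b"
proof transfer
  fix a b
  have "free_mon 1 {#a + b#} - free_mon 1 {#a#} - free_mon 1 {#b#} \<in> linearity_ideal"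
    by (rule linearity_ideal_base) (auto simp: linearity_relations_def)
  then show "boson_rel (free_mon 1 {#a + b#}) (free_mon 1 {#a#} + free_mon 1 {#b#})"
    by (simp add: boson_rel_def diff_diff_add)
qed

lemma of_kform_scale: "of_kform (scale_kform c a) = scale_boson c (of_kform a)"
proof transfer
  fix c a
  have "free_mon 1 {#scale_kform c a#} - free_mon c {#a#} \<in> linearity_ideal"
    by (rule linearity_ideal_base) (auto simp: linearity_relations_def)
  then show "boson_rel (free_mon 1 {#scale_kform c a#}) (free_mon c {#} * free_mon 1 {#a#})"
    by (simp add: boson_rel_def mult_single)
qed

text \<open>
  For a subspace \<open>U\<close> of \<open>K\<close> the map \<open>S\<^sup>*U \<rightarrow> S\<^sup>*K\<close> is injective; \<open>sym_sub U\<close> is its image.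
\<close>

definition sym_sub :: "kform set \<Rightarrow> boson set" where
  "sym_sub U = boson.span {prod_mset (image_mset of_kform m) | m. set_mset m \<subseteq> U}"

definition W_poles_in :: "complex set \<Rightarrow> boson set" where
  "W_poles_in S = sym_sub (kforms_poles_in S)"

definition W_regular_on :: "complex set \<Rightarrow> boson set" where
  "W_regular_on S = sym_sub (kforms_regular_on S)"

subsection \<open>Translations and rotations\<close>

definition free_map :: "(kform \<Rightarrow> kform) \<Rightarrow> free_boson \<Rightarrow> free_boson" where
  "free_map f p = (\<Sum>m\<in>Poly_Mapping.keys p. free_mon (Poly_Mapping.lookup p m) (image_mset f m))"

lemma free_map_superset:
  assumes "finite A" "Poly_Mapping.keys p \<subseteq> A"
  shows "free_map f p = (\<Sum>m\<in>A. free_mon (Poly_Mapping.lookup p m) (image_mset f m))"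
  unfolding free_map_def using assms
  by (intro sum.mono_neutral_left) (auto simp: in_keys_iff)

lemma free_map_add: "free_map f (p + q) = free_map f p + free_map f q"
proof -
  let ?A = "Poly_Mapping.keys p \<union> Poly_Mapping.keys q"
  have "Poly_Mapping.keys (p + q) \<subseteq> ?A"
    by (rule keys_add)
  then show ?thesis
    using free_map_superset[of ?A p f] free_map_superset[of ?A q f] free_map_superset[of ?A "p + q" f]
    by (simp add: lookup_add single_add sum.distrib)
qed

lemma free_map_0 [simp]: "free_map f 0 = 0"
  by (simp add: free_map_def)

lemma free_map_single [simp]: "free_map f (free_mon c m) = free_mon c (image_mset f m)"
  by (cases "c = 0") (simp_all add: free_map_def)

lemma free_map_1 [simp]: "free_map f 1 = 1"
  using free_map_single[where c = 1 and m = "{#}"] by simp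

lemma free_map_diff: "free_map f (p - q) = free_map f p - free_map f q"
  using free_map_add[of f "p - q" q] by simp

lemma poly_mapping_sum_single:
  "p = (\<Sum>m\<in>Poly_Mapping.keys p. Poly_Mapping.single m (Poly_Mapping.lookup p m))"
  by (rule poly_mapping_eqI) (auto simp: lookup_sum lookup_single when_def in_keys_iff)

lemma free_map_sum: "finite I \<Longrightarrow> free_map f (\<Sum>i\<in>I. g i) = (\<Sum>i\<in>I. free_map f (g i))"
  by (induction I rule: finite_induct) (simp_all add: free_map_add)

lemma free_map_mult: "free_map f (p * q) = free_map f p * free_map f q"
proof -
  have "free_map f (p * q) =
    free_map f (\<Sum>m\<in>Poly_Mapping.keys p. \<Sum>n\<in>Poly_Mapping.keys q.
      free_mon (Poly_Mapping.lookup p m) m * free_mon (Poly_Mapping.lookup q n) n)"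
    by (subst (1) poly_mapping_sum_single[of p], subst (1) poly_mapping_sum_single[of q])
      (simp add: sum_product)
  also have "\<dots> = free_map f p * free_map f q"
    by (simp add: free_map_sum mult_single sum_product) (simp add: free_map_def sum_product mult_single)
  finally show ?thesis .
qed

text \<open>The endomorphism of the algebra \<open>S\<^sup>*K\<close> induced by \<open>pull_kform c b\<close>.\<close>

lift_definition pull_boson :: "complex \<Rightarrow> complex \<Rightarrow> boson \<Rightarrow> boson"
  is "\<lambda>c b. free_map (pull_kform c b)"
proof -
  fix c b p q
  let ?f = "free_map (pull_kform c b)"
  have *: "?f p \<in> linearity_ideal" if "p \<in> linearity_ideal" for p
    using that[unfolded linearity_ideal_def]
  proof (induction rule: module.span_induct_alt[OF module_times, consumes 1])
    case 1
    show ?case by (simp add: linearity_ideal_0)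
  next
    case (2 r x y)
    then have "?f x \<in> linearity_relations"
      by (fastforce simp: linearity_relations_def free_map_diff pull_kform_add pull_kform_scale)
    then show ?case
      using 2 by (auto simp: free_map_add free_map_mult
          intro: linearity_ideal_add linearity_ideal_mult linearity_ideal_base)
  qed
  assume "boson_rel p q"
  then show "boson_rel (?f p) (?f q)"
    using *[of "p - q"] by (simp add: boson_rel_def free_map_diff)
qed

lemma pull_boson_add: "pull_boson c b (x + y) = pull_boson c b x + pull_boson c b y"
  by transfer (simp add: boson_rel_def linearity_ideal_0 free_map_add)

lemma pull_boson_mult: "pull_boson c b (x * y) = pull_boson c b x * pull_boson c b y"
  by transfer (simp add: boson_rel_def linearity_ideal_0 free_map_mult)

lemma pull_boson_1: "pull_boson c b 1 = 1"
  by transfer (simp add: boson_rel_def linearity_ideal_0)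

lemma pull_boson_scale: "pull_boson c b (scale_boson k x) = scale_boson k (pull_boson c b x)"
  by transfer (simp add: boson_rel_def linearity_ideal_0 free_map_mult)

lemma pull_boson_of_kform: "pull_boson c b (of_kform a) = of_kform (pull_kform c b a)"
  by transfer (simp add: boson_rel_def linearity_ideal_0)

definition T_op :: "complex \<Rightarrow> boson \<Rightarrow> boson" where
  "T_op v = pull_boson 1 (- v)"

definition rotate_about :: "complex \<Rightarrow> complex \<Rightarrow> complex \<Rightarrow> complex" where
  "rotate_about q l z = q + l * (z - q)"

text \<open>The inverse of \<open>rotate_about q l\<close> is \<open>u \<mapsto> (1 / l) * u + (q - q / l)\<close>.\<close>

definition R_op :: "complex \<Rightarrow> complex \<Rightarrow> boson \<Rightarrow> boson" where
  "R_op q l = pull_boson (1 / l) (q - q / l)"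

section \<open>Vertex algebra structures\<close>

text \<open>
  For finite \<open>S\<close> and \<open>x \<in> W_poles_in S\<close> the operator \<open>Y(x, v)\<close>, with \<open>x\<close> regarded as a state
  in \<open>W_poles_in S\<close>, is \<open>Y S x v\<close>. Its domain is \<open>W_regular_on ((+) v ` S)\<close>; the values of
  \<open>Y\<close> at other arguments are arbitrary.
  In \<open>spanning\<close>, \<open>[(x1, v1), ..., (xn, vn)]\<close> yields the vector \<open>Y(xn, vn) ... Y(x1, v1) 1\<close>;
  by translation covariance the condition does not depend on the point \<open>q\<close>.
\<close>

locale boson_vertex_algebra =
  fixes Y :: "complex set \<Rightarrow> boson \<Rightarrow> complex \<Rightarrow> boson \<Rightarrow> boson"
  assumes state_add:
      "\<lbrakk>finite S; x \<in> W_poles_in S; y \<in> W_poles_in S; w \<in> W_regular_on ((+) v ` S)\<rbrakk>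
        \<Longrightarrow> Y S (x + y) v w = Y S x v w + Y S y v w"
    and state_scale:
      "\<lbrakk>finite S; x \<in> W_poles_in S; w \<in> W_regular_on ((+) v ` S)\<rbrakk>
        \<Longrightarrow> Y S (scale_boson c x) v w = scale_boson c (Y S x v w)"
    and operator_add:
      "\<lbrakk>finite S; x \<in> W_poles_in S; w \<in> W_regular_on ((+) v ` S); w' \<in> W_regular_on ((+) v ` S)\<rbrakk>
        \<Longrightarrow> Y S x v (w + w') = Y S x v w + Y S x v w'"
    and operator_scale:
      "\<lbrakk>finite S; x \<in> W_poles_in S; w \<in> W_regular_on ((+) v ` S)\<rbrakk>
        \<Longrightarrow> Y S x v (scale_boson c w) = scale_boson c (Y S x v w)"
    and enlarge:
      "\<lbrakk>finite S'; S \<subseteq> S'; x \<in> W_poles_in S; w \<in> W_regular_on ((+) v ` S')\<rbrakk>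
        \<Longrightarrow> Y S' x v w = Y S x v w"
    and poles:
      "\<lbrakk>finite S; finite S'; x \<in> W_poles_in S; x' \<in> W_poles_in S' \<inter> W_regular_on ((+) v ` S)\<rbrakk>
        \<Longrightarrow> Y S x v x' \<in> W_poles_in (S' \<union> (+) v ` S)"
    and vacuum:
      "\<lbrakk>finite S; w \<in> W_regular_on ((+) v ` S)\<rbrakk> \<Longrightarrow> Y S 1 v w = w"
    and creation:
      "\<lbrakk>finite S; x \<in> W_poles_in S\<rbrakk> \<Longrightarrow> Y S x 0 1 = x"
    and locality:
      "\<lbrakk>finite S; finite S'; x \<in> W_poles_in S; x' \<in> W_poles_in S'; (+) v ` S \<inter> (+) v' ` S' = {};
        w \<in> W_regular_on ((+) v ` S); w \<in> W_regular_on ((+) v' ` S');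
        Y S x v w \<in> W_regular_on ((+) v' ` S'); Y S' x' v' w \<in> W_regular_on ((+) v ` S)\<rbrakk>
        \<Longrightarrow> Y S x v (Y S' x' v' w) = Y S' x' v' (Y S x v w)"
    and translation:
      "\<lbrakk>finite S; x \<in> W_poles_in S; w \<in> W_regular_on ((+) (v + v') ` S)\<rbrakk>
        \<Longrightarrow> Y S x (v + v') w = T_op v' (Y S x v (T_op (- v') w))"
    and translation_covariance:
      "\<lbrakk>finite S; x \<in> W_poles_in S; w \<in> W_regular_on ((+) (v + v') ` S)\<rbrakk>
        \<Longrightarrow> Y ((+) v' ` S) (T_op v' x) v w = T_op v' (Y S x v (T_op (- v') w))"
    and rotation_covariance:
      "\<lbrakk>finite S; x \<in> W_poles_in S; l \<noteq> 0; w \<in> W_regular_on (rotate_about q l ` (+) v ` S)\<rbrakk>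
        \<Longrightarrow> Y (rotate_about q l ` S) (R_op q l x) (l * v) w = R_op q l (Y S x v (R_op q (1 / l) w))"
    and spanning:
      "\<exists>q. boson.span {fold (\<lambda>(x, v). Y {q} x v) xs 1 | xs.
             distinct (map snd xs) \<and> set (map fst xs) \<subseteq> W_poles_in {q}} = UNIV"

end

theory Submission
  imports Defs
begin

text \<open>
  A state is recovered from its operator by applying the operator to the vacuum: creation gives
  \<open>Y(x, 0) 1 = x\<close>, and, the vacuum being translation invariant, \<open>Y(x, v) 1 = T\<^sub>v x\<close>. Writing \<open>x2\<close> as
  \<open>Y(x2, 0) 1\<close> turns the left-hand side into \<open>Y(x1, v) Y(x2, 0) 1\<close>. The disjointness hypothesis is
  just what locality asks for, so this equals \<open>Y(x2, 0) Y(x1, v) 1 = Y(x2, 0) T\<^sub>v x1\<close>; and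
  conjugating \<open>Y(x2, -v)\<close> by \<open>T\<^sub>v\<close> shows that \<open>Y(x2, 0) T\<^sub>v = T\<^sub>v Y(x2, -v)\<close>.

  Besides these axioms one needs that translations act on \<open>S\<^sup>*K\<close> as a group and move poles by
  translation (\<open>T_op_W_poles_in\<close>), so that every vector above lies in the domain of the operator
  applied to it.
\<close>

lemma pull_kform_pull_kform:
  "pull_kform c b (pull_kform c' b' a) = pull_kform (c * c') (c' * b + b') a"
proof transfer
  fix c b c' b' a assume "kform_rel a a"
  then have "is_kform (\<lambda>u. c * (c' * a (c' * (c * u + b) + b')))"
    using is_kform_affine[of "\<lambda>u. c' * a (c' * u + b')" c b] is_kform_affine[of a c' b']
    by (simp add: kform_rel_def)
  then show "kform_rel (\<lambda>u. c * (c' * a (c' * (c * u + b) + b')))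
                       (\<lambda>u. c * c' * a (c * c' * u + (c' * b + b')))"
    by (simp add: kform_rel_def algebra_simps)
qed

lemma pull_kform_id: "pull_kform 1 0 = (\<lambda>a. a)"
  by (rule ext, transfer) simp

lemma free_map_free_map: "free_map f (free_map g p) = free_map (f \<circ> g) p"
  unfolding free_map_def[of g] free_map_def[of "f \<circ> g"]
  by (simp add: free_map_sum multiset.map_comp)

lemma free_map_id: "free_map (\<lambda>a. a) p = p"
  using poly_mapping_sum_single[of p] by (simp add: free_map_def)

lemma pull_boson_pull_boson:
  "pull_boson c b (pull_boson c' b' x) = pull_boson (c * c') (c' * b + b') x"
  by transfer
    (simp add: free_map_free_map o_def pull_kform_pull_kform boson_rel_def linearity_ideal_0)

lemma pull_boson_id: "pull_boson 1 0 x = x"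
  by transfer (simp add: pull_kform_id free_map_id boson_rel_def linearity_ideal_0)

lemma T_op_minus_T_op: "T_op (- v) (T_op v x) = x"
  by (simp add: T_op_def pull_boson_pull_boson pull_boson_id)

lemma T_op_1: "T_op v 1 = 1"
  by (simp add: T_op_def pull_boson_1)

lemma pull_boson_prod_mset:
  "pull_boson c b (prod_mset (image_mset of_kform m)) =
     prod_mset (image_mset of_kform (image_mset (pull_kform c b) m))"
  by (induction m) (simp_all add: pull_boson_1 pull_boson_mult pull_boson_of_kform)

lemma pull_boson_sym_sub:
  assumes "\<And>a. a \<in> U \<Longrightarrow> pull_kform c b a \<in> U'" and "x \<in> sym_sub U"
  shows "pull_boson c b x \<in> sym_sub U'"
  using assms(2) unfolding sym_sub_def
proof (induction rule: boson.span_induct_alt)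
  case base
  have "pull_boson c b 0 = 0"
    using pull_boson_add[of c b 0 0] by simp
  then show ?case
    by (simp add: boson.span_zero)
next
  case (step k y z)
  then obtain m where m: "y = prod_mset (image_mset of_kform m)" "set_mset m \<subseteq> U"
    by blast
  then have "set_mset (image_mset (pull_kform c b) m) \<subseteq> U'"
    using assms(1) by auto
  then have "pull_boson c b y \<in> {prod_mset (image_mset of_kform m) | m. set_mset m \<subseteq> U'}"
    using m(1) pull_boson_prod_mset by blast
  then show ?case
    using step by (simp add: pull_boson_add pull_boson_scale
        boson.span_add boson.span_scale boson.span_base)
qed

lemma sym_sub_mono: "U \<subseteq> U' \<Longrightarrow> sym_sub U \<subseteq> sym_sub U'"
  unfolding sym_sub_def by (intro boson.span_mono) blast

lemma one_in_sym_sub: "1 \<in> sym_sub U"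
  unfolding sym_sub_def by (intro boson.span_base CollectI exI[of _ "{#}"]) simp

lemma pole_of_translate: "pole_of (pull_kform 1 b a) z \<longleftrightarrow> pole_of a (z + b)"
proof transfer
  fix b z :: complex and a :: "complex \<Rightarrow> complex"
  show "is_pole (\<lambda>u. 1 * a (1 * u + b)) z = is_pole a (z + b)"
    using at_to_0[of z] at_to_0[of "z + b"]
    by (simp add: is_pole_def filterlim_filtermap add_ac)
qed

lemma T_op_W_poles_in:
  assumes "x \<in> W_poles_in S"
  shows "T_op v x \<in> W_poles_in ((+) v ` S)"
proof -
  have "pull_kform 1 (- v) a \<in> kforms_poles_in ((+) v ` S)" if "a \<in> kforms_poles_in S" for a
  proof -
    have "z \<in> (+) v ` S" if "pole_of (pull_kform 1 (- v) a) z" for z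
      using that \<open>a \<in> kforms_poles_in S\<close>
      by (intro image_eqI[of _ _ "z - v"]) (auto simp: pole_of_translate kforms_poles_in_def)
    then show ?thesis
      by (simp add: kforms_poles_in_def)
  qed
  then show ?thesis
    using assms unfolding T_op_def W_poles_in_def by (rule pull_boson_sym_sub)
qed

lemma W_poles_in_subset_W_regular_on: "S \<inter> S' = {} \<Longrightarrow> W_poles_in S \<subseteq> W_regular_on S'"
  unfolding W_poles_in_def W_regular_on_def
  by (rule sym_sub_mono) (auto simp: kforms_poles_in_def kforms_regular_on_def)

lemma one_in_W_regular_on: "1 \<in> W_regular_on S"
  by (simp add: W_regular_on_def one_in_sym_sub)

context boson_vertex_algebra
begin

lemma creation_translated:
  assumes "finite S" and "x \<in> W_poles_in S"
  shows "Y S x v 1 = T_op v x"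
  using translation[of S x 1 0 v] assms by (simp add: one_in_W_regular_on T_op_1 creation)

lemma intertwine_translation:
  assumes "finite S" and "x \<in> W_poles_in S" and "T_op v w \<in> W_regular_on S"
  shows "Y S x 0 (T_op v w) = T_op v (Y S x (- v) w)"
  using translation[of S x "T_op v w" "- v" v] assms by (simp add: T_op_minus_T_op)

end

theorem proposition10p3:
  fixes Y :: "complex set \<Rightarrow> boson \<Rightarrow> complex \<Rightarrow> boson \<Rightarrow> boson"
    and S1 S2 :: "complex set" and x1 x2 :: boson and v :: complex
  assumes "boson_vertex_algebra Y"
    and "finite S1" and "finite S2"
    and "x1 \<in> W_poles_in S1" and "x2 \<in> W_poles_in S2"
    and "S2 \<inter> (+) v ` S1 = {}"
  shows "Y S1 x1 v x2 = T_op v (Y S2 x2 (- v) x1)"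
proof -
  interpret boson_vertex_algebra Y
    by (rule assms(1))
  have x2: "Y S2 x2 0 1 = x2"
    using assms by (intro creation)
  have x1: "Y S1 x1 v 1 = T_op v x1"
    using assms by (intro creation_translated)
  have regular1: "T_op v x1 \<in> W_regular_on S2"
    using T_op_W_poles_in[OF assms(4)] W_poles_in_subset_W_regular_on assms(6) by blast
  have regular2: "x2 \<in> W_regular_on ((+) v ` S1)"
    using assms(5,6) W_poles_in_subset_W_regular_on by blast
  have "Y S1 x1 v x2 = Y S1 x1 v (Y S2 x2 0 1)"
    by (simp add: x2)
  also have "\<dots> = Y S2 x2 0 (Y S1 x1 v 1)"
    using assms regular1 regular2
    by (intro locality) (auto simp: x1 x2 one_in_W_regular_on)
  also have "\<dots> = T_op v (Y S2 x2 (- v) x1)"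
    using assms regular1 by (simp add: x1 intertwine_translation)
  finally show ?thesis .
qed

end
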